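(* Let $k\ge1$ be an integer, $\lambda>0$, let $\Theta\subseteq\mathbb{R}$ be arbitrary, and let the source model $\mathcal{U}$ be the Erlang location model on $\mathbb{X}=\mathbb{R}$ with density $$u(x;\theta)=\frac{\lambda^k}{(k-1)!}(x-\theta)^{k-1}e^{-\lambda(x-\theta)}\quad\text{for }x\ge\theta,\qquad u(x;\theta)=0\text{ for }x<\theta.$$ Let the target model $\mathcal{V}$ have densities $v(y;\theta)$ on $\mathbb{Y}$, defined for all $\theta\in\mathbb{R}$ and $k$ times differentiable in $\theta$. Suppose that for each $y\in\mathbb{Y}$, $w\in\mathbb{R}$ and $0\le j\le k-1$, $$\lim_{x\to+\infty}x^{k-1}e^{-\lambda x}\,\nabla^{(j)}_\theta v(y;\theta)\big|_{\theta=x+w}=0,$$ and additionally, if $k\ge2$, that $$\lim_{x\to0}x\cdot v(y;\theta)\big|_{\theta=x+w}=0,\qquad \lim_{x\to0}x^{k-1}\,\nabla^{(j)}_\theta v(y;\theta)\big|_{\theta=x+w}=0.$$ Then the signed kernel $$\mathcal{S}^*(y|x)=\sum_{j=0}^k\binom{k}{j}\lambda^{-j}\,\nabla^{(j)}_tv(y;-t)\Big|_{t=-x}$$ attains $\varsigma(\mathcal{U},\mathcal{V};\mathcal{S}^* )=0$.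
   Context: $\nabla^{(j)}$ denotes the $j$-th derivative with respect to the indicated variable; in the definition of $\mathcal{S}^*$ the function differentiated is $t\mapsto v(y;-t)$. The limits are pointwise (no uniformity is required). $\mathbb{Y}$ is a measurable subset of a Euclidean space and densities are with respect to Lebesgue measure. A signed kernel with density $\mathcal{S}(y|x)$ assigns to each $x\in\mathbb{X}$ the signed measure $\mathcal{S}(y|x)\,\mathrm{d}y$ on $\mathbb{Y}$. The signed deficiency is $$\varsigma(\mathcal{U},\mathcal{V};\mathcal{S})=\sup_{\theta\in\Theta}\frac12\int_{\mathbb{Y}}\Big|v(y;\theta)-\int_{\mathbb{X}}\mathcal{S}(y|x)\,u(x;\theta)\,\mathrm{d}x\Big|\,\mathrm{d}y.$$ *)

theory Defs
  imports "HOL-Probability.Distributions"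
begin

definition times_differentiable :: "nat \<Rightarrow> (real \<Rightarrow> real) \<Rightarrow> bool" where
  "times_differentiable k f \<longleftrightarrow> (\<forall>j<k. \<forall>x. (deriv ^^ j) f differentiable (at x))"

definition prob_density_on :: "'a::euclidean_space set \<Rightarrow> ('a \<Rightarrow> real) \<Rightarrow> bool" where
  "prob_density_on Y f \<longleftrightarrow>
     f \<in> borel_measurable (lebesgue_on Y) \<and> (\<forall>y\<in>Y. 0 \<le> f y) \<and>
     (\<integral>\<^sup>+ y. ennreal (f y) \<partial>lebesgue_on Y) = 1"

(* The library's shape index is shifted by one: its erlang_density n has shape n + 1. *)
definition erlang_location :: "nat \<Rightarrow> real \<Rightarrow> real \<Rightarrow> real \<Rightarrow> real" where
  "erlang_location k lam x \<theta> = erlang_density (k - 1) lam (x - \<theta>)"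

lemma erlang_location_eq:
  assumes "k \<ge> 1"
  shows "erlang_location k lam x \<theta> =
    (if x \<ge> \<theta> then lam ^ k / fact (k - 1) * (x - \<theta>) ^ (k - 1) * exp (- lam * (x - \<theta>)) else 0)"
  using assms by (cases k) (auto simp: erlang_location_def erlang_density_def)

(* Densities and kernels take the observed variable first: u x \<theta>, v y \<theta>, S y x.
   The integral over X is the gauge (Henstock-Kurzweil) integral. It equals the Lebesgue integral
   whenever the latter exists, and it also covers conditionally convergent improper integrals.
   These cannot be avoided for kernels built from derivatives of v: even for smooth bounded v,
   the function S y x * u x \<theta> need not be absolutely integrable in x.
   The supremum is taken in ennreal, so it is 0 for an empty \<Theta>. *)
definition signed_deficiency ::
  "real set \<Rightarrow> 'b::euclidean_space set \<Rightarrow> 'a::euclidean_space set \<Rightarrow>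
   ('b \<Rightarrow> real \<Rightarrow> real) \<Rightarrow> ('a \<Rightarrow> real \<Rightarrow> real) \<Rightarrow> ('a \<Rightarrow> 'b \<Rightarrow> real) \<Rightarrow> ennreal" where
  "signed_deficiency \<Theta> X Y u v S =
     (SUP \<theta>\<in>\<Theta>. ennreal (1 / 2) *
        (\<integral>\<^sup>+ y. ennreal \<bar>v y \<theta> - integral X (\<lambda>x. S y x * u x \<theta>)\<bar> \<partial>lebesgue_on Y))"

definition erlang_kernel :: "nat \<Rightarrow> real \<Rightarrow> ('a \<Rightarrow> real \<Rightarrow> real) \<Rightarrow> 'a \<Rightarrow> real \<Rightarrow> real" where
  "erlang_kernel k lam v y x =
     (\<Sum>j=0..k. real (k choose j) * inverse lam ^ j * (deriv ^^ j) (\<lambda>t. v y (- t)) (- x))"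

end

theory Submission
  imports Defs
begin

text \<open>For fixed \<open>y\<close> write \<open>f = v y\<close> and \<open>D\<close> for the derivative. The kernel is
  \<open>(1 - D / lam) ^ k f\<close>, and \<open>1 - D / lam\<close> is conjugate to \<open>- D / lam\<close> by \<open>x \<mapsto> exp (- lam * x)\<close>.
  With \<open>s = x - \<theta>\<close> and \<open>g = exp (- lam * s) * f\<close>, the integrand is therefore
  \<open>(-1) ^ k * s ^ (k - 1) / fact (k - 1) * D ^ k g\<close>. Repeated integration by parts gives the
  antiderivative \<open>\<Sum>i<k. (-1) ^ (i + 1) * s ^ i / fact i * D ^ i g\<close>, which equals \<open>- f \<theta>\<close> at
  \<open>x = \<theta>\<close> and tends to \<open>0\<close> at infinity by the growth hypothesis.\<close>

section \<open>Improper integrals over a half-line\<close>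

text \<open>A gauge integral over an unbounded set is a limit of integrals over growing boxes, so
  convergence of \<open>G\<close> suffices and \<open>g\<close> may be only conditionally
  integrable.\<close>

lemma has_integral_FTC_at_top:
  fixes G g :: "real \<Rightarrow> real"
  assumes deriv: "\<And>x. x \<ge> a \<Longrightarrow> (G has_real_derivative g x) (at x)"
    and lim: "(G \<longlongrightarrow> l) at_top"
  shows "(g has_integral (l - G a)) {a..}"
proof -
  have fin: "((\<lambda>x. if x \<in> {a..} then g x else 0) has_integral (G d - G a)) (cbox c d)"
    if "c \<le> a" "a \<le> d" for c d
  proof -
    have "(g has_integral (G d - G a)) {a..d}"
      by (rule fundamental_theorem_of_calculus)
        (use that deriv in \<open>auto simp flip: has_real_derivative_iff_has_vector_derivative
          intro: has_field_derivative_at_within\<close>)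
    then have "((\<lambda>x. if x \<in> {a..d} then g x else 0) has_integral (G d - G a)) (cbox c d)"
      using that by (subst has_integral_restrict) auto
    then show ?thesis
      by (rule has_integral_eq[rotated]) auto
  qed
  show ?thesis
    unfolding has_integral_alt'[of g]
  proof (intro conjI allI impI)
    fix c d :: real
    \<comment> \<open>\<open>fin\<close> covers only boxes containing \<open>a\<close>, so the box
      is enlarged to one of these and integrability restricted back.\<close>
    define c' d' where "c' = min c a" and "d' = max d a"
    have "(\<lambda>x. if x \<in> {a..} then g x else 0) integrable_on cbox c' d'"
      using fin[of c' d'] by (auto simp: c'_def d'_def integrable_on_def)
    then show "(\<lambda>x. if x \<in> {a..} then g x else 0) integrable_on cbox c d"
      by (rule integrable_on_subcbox) (auto simp: c'_def d'_def)
  next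
    fix e :: real
    assume "e > 0"
    with lim obtain N where N: "\<And>x. x \<ge> N \<Longrightarrow> \<bar>G x - l\<bar> < e"
      by (auto simp: tendsto_iff dist_real_def eventually_at_top_linorder)
    \<comment> \<open>The summand 1 puts the points at distance
      \<open>\<bar>a\<bar> + \<bar>N\<bar>\<close> from 0 inside the open ball, so the box contains
      \<open>a\<close> and reaches \<open>N\<close>.\<close>
    define B where "B = \<bar>a\<bar> + \<bar>N\<bar> + 1"
    have "norm (integral (cbox c d) (\<lambda>x. if x \<in> {a..} then g x else 0) - (l - G a)) < e"
      if "ball 0 B \<subseteq> cbox c d" for c d :: real
    proof -
      have "\<bar>a\<bar> + \<bar>N\<bar> \<in> cbox c d" "- (\<bar>a\<bar> + \<bar>N\<bar>) \<in> cbox c d"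
        using that by (auto simp: B_def subset_iff)
      then have "c \<le> a" "a \<le> d" "N \<le> d"
        by auto
      with fin[of c d] N[of d] show ?thesis
        by (simp add: integral_unique)
    qed
    then show "\<exists>B>0. \<forall>c d. ball 0 B \<subseteq> cbox c d \<longrightarrow>
        norm (integral (cbox c d) (\<lambda>x. if x \<in> {a..} then g x else 0) - (l - G a)) < e"
      by (intro exI[of _ B]) (auto simp: B_def)
  qed
qed

section \<open>Iterated derivatives and reflection\<close>

lemma times_differentiable_has_derivative:
  assumes "times_differentiable k f" "j < k"
  shows "((deriv ^^ j) f has_real_derivative (deriv ^^ Suc j) f x) (at x)"
  using assms by (simp add: times_differentiable_def DERIV_deriv_iff_real_differentiable)

text \<open>The chain rule gives one factor -1 per derivative. At \<open>t = - x\<close> this turns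
  the kernel into a combination of derivatives of \<open>v y\<close> at \<open>x\<close>.\<close>

lemma higher_deriv_reflect:
  assumes "times_differentiable k f" "j \<le> k"
  shows "(deriv ^^ j) (\<lambda>t. f (- t)) t = (-1) ^ j * (deriv ^^ j) f (- t)"
  using assms(2)
proof (induction j arbitrary: t)
  case (Suc j)
  then have eq: "(deriv ^^ j) (\<lambda>t. f (- t)) = (\<lambda>t. (-1) ^ j * (deriv ^^ j) f (- t))"
    by auto
  have "((\<lambda>t. (-1) ^ j * (deriv ^^ j) f (- t)) has_real_derivative
      (-1) ^ j * ((deriv ^^ Suc j) f (- t) * (- 1))) (at t)"
    using Suc.prems assms(1)
    by (intro DERIV_cmult DERIV_chain2[OF times_differentiable_has_derivative])
      (auto intro!: derivative_eq_intros)
  from DERIV_imp_deriv[OF this] show ?case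
    by (simp add: eq)
qed simp

section \<open>Derivatives twisted by an exponential\<close>

text \<open>Pascal's rule, as the induction step of Leibniz's formula: the left side is what the
  product rule leaves after the exponential is factored out, with \<open>a j\<close> the derivatives
  of \<open>f\<close>.\<close>

lemma sum_choose_Suc:
  fixes c :: real
  shows "(\<Sum>j\<le>n. real (n choose j) * c ^ (n - j) * a (Suc j))
      + c * (\<Sum>j\<le>n. real (n choose j) * c ^ (n - j) * a j)
    = (\<Sum>j\<le>Suc n. real (Suc n choose j) * c ^ (Suc n - j) * a j)"
proof -
  have "c * (\<Sum>j\<le>n. real (n choose j) * c ^ (n - j) * a j)
      = (\<Sum>j\<le>Suc n. real (n choose j) * c ^ (Suc n - j) * a j)"
    \<comment> \<open>The added index \<open>Suc n\<close> contributes nothing, as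
      \<open>n choose Suc n\<close> is 0.\<close>
    by (auto simp: sum_distrib_left Suc_diff_le binomial_eq_0 intro!: sum.cong)
  also have "\<dots> = c ^ Suc n * a 0 + (\<Sum>j\<le>n. real (n choose Suc j) * c ^ (n - j) * a (Suc j))"
    by (subst sum.atMost_Suc_shift) simp
  finally show ?thesis
    by (subst sum.atMost_Suc_shift) (simp add: sum.distrib algebra_simps)
qed

text \<open>This is the \<open>i\<close>-th derivative of \<open>exp (c * (x - \<theta>)) * f x\<close>.\<close>

definition exp_twist :: "real \<Rightarrow> real \<Rightarrow> (real \<Rightarrow> real) \<Rightarrow> nat \<Rightarrow> real \<Rightarrow> real" where
  "exp_twist c \<theta> f i x =
     exp (c * (x - \<theta>)) * (\<Sum>j\<le>i. real (i choose j) * c ^ (i - j) * (deriv ^^ j) f x)"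

lemma exp_twist_has_derivative:
  assumes "times_differentiable k f" "i < k"
  shows "(exp_twist c \<theta> f i has_real_derivative exp_twist c \<theta> f (Suc i) x) (at x)"
proof -
  have "((\<lambda>x. \<Sum>j\<le>i. real (i choose j) * c ^ (i - j) * (deriv ^^ j) f x) has_real_derivative
      (\<Sum>j\<le>i. real (i choose j) * c ^ (i - j) * (deriv ^^ Suc j) f x)) (at x)"
    using assms by (intro DERIV_sum DERIV_cmult times_differentiable_has_derivative) auto
  moreover have "((\<lambda>x. exp (c * (x - \<theta>))) has_real_derivative c * exp (c * (x - \<theta>))) (at x)"
    by (auto intro!: derivative_eq_intros)
  ultimately show ?thesis
    unfolding exp_twist_def sum_choose_Suc[symmetric]
    by (auto dest: DERIV_mult simp: algebra_simps)
qed

text \<open>After the shift by \<open>\<theta>\<close> this is a finite sum of terms with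
  derivatives of order below \<open>k\<close>. For \<open>x \<ge> 1\<close> the power
  \<open>x ^ m\<close> is at most \<open>x ^ (k - 1)\<close>, so the hypothesis dominates each
  term.\<close>

lemma exp_twist_tendsto_0:
  assumes "i < k" "m < k"
    and lim: "\<And>j. j < k \<Longrightarrow>
      ((\<lambda>x. x ^ (k - 1) * exp (c * x) * (deriv ^^ j) f (x + \<theta>)) \<longlongrightarrow> 0) at_top"
  shows "((\<lambda>x. (x - \<theta>) ^ m * exp_twist c \<theta> f i x) \<longlongrightarrow> 0) at_top"
proof -
  have low: "((\<lambda>x. x ^ m * exp (c * x) * (deriv ^^ j) f (x + \<theta>)) \<longlongrightarrow> 0) at_top"
    if "j < k" for j
  proof (rule Lim_null_comparison[OF _ tendsto_norm_zero[OF lim[OF that]]])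
    have "norm (x ^ m * exp (c * x) * (deriv ^^ j) f (x + \<theta>))
        \<le> norm (x ^ (k - 1) * exp (c * x) * (deriv ^^ j) f (x + \<theta>))" if "x \<ge> 1" for x
    proof -
      have "x ^ m \<le> x ^ (k - 1)"
        using \<open>m < k\<close> that by (intro power_increasing) auto
      then show ?thesis
        using that by (auto simp: abs_mult intro!: mult_right_mono)
    qed
    then show "\<forall>\<^sub>F x in at_top. norm (x ^ m * exp (c * x) * (deriv ^^ j) f (x + \<theta>))
        \<le> norm (x ^ (k - 1) * exp (c * x) * (deriv ^^ j) f (x + \<theta>))"
      by (auto simp: eventually_at_top_linorder)
  qed
  have "((\<lambda>x. \<Sum>j\<le>i. real (i choose j) * c ^ (i - j) *
      (x ^ m * exp (c * x) * (deriv ^^ j) f (x + \<theta>))) \<longlongrightarrow> 0) at_top"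
    using \<open>i < k\<close> by (intro tendsto_null_sum tendsto_mult_right_zero low) auto
  then have "((\<lambda>x. x ^ m * exp_twist c \<theta> f i (x + \<theta>)) \<longlongrightarrow> 0) at_top"
    by (simp add: exp_twist_def sum_distrib_left mult_ac)
  moreover have "filterlim (\<lambda>x. x - \<theta>) at_top at_top"
    using filterlim_tendsto_add_at_top[OF tendsto_const filterlim_ident, of "- \<theta>"] by simp
  ultimately show ?thesis
    by (auto dest: filterlim_compose)
qed

section \<open>Repeated integration by parts\<close>

text \<open>The weight of term \<open>i + 1\<close> has as derivative minus the weight of term
  \<open>i\<close>, so neighbouring contributions cancel and only the last one survives.\<close>

lemma DERIV_taylor_telescope:
  fixes g :: "nat \<Rightarrow> real \<Rightarrow> real"
  assumes "\<And>i. i \<le> n \<Longrightarrow> (g i has_real_derivative g (Suc i) x) (at x)"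
  shows "((\<lambda>x. \<Sum>i\<le>n. (-1) ^ Suc i * (x - a) ^ i / fact i * g i x) has_real_derivative
    (-1) ^ Suc n * (x - a) ^ n / fact n * g (Suc n) x) (at x)"
  using assms
proof (induction n)
  case 0
  then have "(g 0 has_real_derivative g (Suc 0) x) (at x)"
    by simp
  then show ?case
    by (auto intro!: derivative_eq_intros)
next
  case (Suc n)
  have "((\<lambda>x. (-1) ^ Suc (Suc n) * (x - a) ^ Suc n / fact (Suc n)) has_real_derivative
      (-1) ^ Suc (Suc n) * (real (Suc n) * (x - a) ^ n) / fact (Suc n)) (at x)"
    by (rule DERIV_cdivide, rule DERIV_cmult, rule DERIV_cong[OF DERIV_power_Suc[where D = 1]])
      (auto intro!: derivative_eq_intros)
  also have "(-1) ^ Suc (Suc n) * (real (Suc n) * (x - a) ^ n) / fact (Suc n)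
      = - ((-1) ^ Suc n * (x - a) ^ n / fact n)"
    unfolding fact_Suc by (simp add: divide_simps del: of_nat_Suc)
  finally have *: "((\<lambda>x. (-1) ^ Suc (Suc n) * (x - a) ^ Suc n / fact (Suc n)) has_real_derivative
      - ((-1) ^ Suc n * (x - a) ^ n / fact n)) (at x)" .
  show ?case
    unfolding sum.atMost_Suc
    by (rule DERIV_cong[OF DERIV_add[OF Suc.IH DERIV_mult[OF *]]])
      (use Suc.prems in \<open>auto simp: mult_ac\<close>)
qed

text \<open>The two binomial sums agree term by term: reflection supplies \<open>(-1) ^ j\<close>,
  and \<open>(-1) ^ k * (- lam) ^ (k - j)\<close> equals
  \<open>(-1) ^ j * lam ^ (k - j)\<close>.\<close>

lemma erlang_kernel_eq:
  assumes "times_differentiable k (v y)" "lam > 0"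
  shows "lam ^ k * exp (- lam * (x - \<theta>)) * erlang_kernel k lam v y x
    = (-1) ^ k * exp_twist (- lam) \<theta> (v y) k x"
proof -
  have "lam ^ k * (real (k choose j) * inverse lam ^ j * (deriv ^^ j) (\<lambda>t. v y (- t)) (- x))
      = (-1) ^ k * (real (k choose j) * (- lam) ^ (k - j) * (deriv ^^ j) (v y) x)"
    if "j \<le> k" for j
  proof -
    from that obtain m where "k = j + m"
      using le_Suc_ex by blast
    moreover have "(-1 :: real) ^ m * (- lam) ^ m = lam ^ m"
      by (simp flip: power_mult_distrib)
    ultimately show ?thesis
      using assms(2) by (simp add: higher_deriv_reflect[OF assms(1) that] power_add field_simps)
  qed
  then have "lam ^ k * erlang_kernel k lam v y x
      = (-1) ^ k * (\<Sum>j\<le>k. real (k choose j) * (- lam) ^ (k - j) * (deriv ^^ j) (v y) x)"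
    unfolding erlang_kernel_def atLeast0AtMost sum_distrib_left by (intro sum.cong) auto
  then show ?thesis
    by (simp add: exp_twist_def mult_ac)
qed

lemma erlang_kernel_has_integral:
  assumes "k \<ge> 1" "lam > 0" and diff: "times_differentiable k (v y)"
    and lim: "\<And>j. j \<le> k - 1 \<Longrightarrow>
      ((\<lambda>x. x ^ (k - 1) * exp (- lam * x) * (deriv ^^ j) (v y) (x + \<theta>)) \<longlongrightarrow> 0) at_top"
  shows "((\<lambda>x. erlang_kernel k lam v y x * erlang_location k lam x \<theta>) has_integral v y \<theta>) UNIV"
proof -
  obtain n where k: "k = Suc n"
    using \<open>k \<ge> 1\<close> by (cases k) auto
  define g where "g = exp_twist (- lam) \<theta> (v y)"
  define G where "G = (\<lambda>x. \<Sum>i\<le>n. (-1) ^ Suc i * (x - \<theta>) ^ i / fact i * g i x)"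
  have "(G has_real_derivative (-1) ^ k * (x - \<theta>) ^ n / fact n * g k x) (at x)" for x
    unfolding G_def k
    by (rule DERIV_taylor_telescope)
      (use exp_twist_has_derivative[OF diff] in \<open>auto simp: g_def k\<close>)
  moreover have "(-1) ^ k * (x - \<theta>) ^ n / fact n * g k x
      = erlang_kernel k lam v y x * erlang_location k lam x \<theta>" if "x \<ge> \<theta>" for x
  proof -
    have "(-1) ^ k * (x - \<theta>) ^ n / fact n * g k x = (-1) ^ k * g k x * ((x - \<theta>) ^ n / fact n)"
      by simp
    also have "(-1) ^ k * g k x = lam ^ k * exp (- lam * (x - \<theta>)) * erlang_kernel k lam v y x"
      unfolding g_def using diff \<open>lam > 0\<close> by (rule erlang_kernel_eq[symmetric])
    finally show ?thesis
      using that by (simp add: erlang_location_eq k mult_ac)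
  qed
  moreover have "(G \<longlongrightarrow> 0) at_top"
  proof -
    have "((\<lambda>x. (-1) ^ Suc i / fact i * ((x - \<theta>) ^ i * g i x)) \<longlongrightarrow> 0) at_top" if "i \<le> n" for i
      using that lim unfolding g_def
      by (intro tendsto_mult_right_zero exp_twist_tendsto_0[where k = k]) (auto simp: k)
    then show ?thesis
      unfolding G_def by (intro tendsto_null_sum) (simp add: mult_ac)
  qed
  ultimately have "((\<lambda>x. erlang_kernel k lam v y x * erlang_location k lam x \<theta>)
      has_integral (0 - G \<theta>)) {\<theta>..}"
    by (intro has_integral_FTC_at_top) (auto intro: DERIV_cong)
  moreover have "G \<theta> = - v y \<theta>"
  proof -
    \<comment> \<open>At \<open>x = \<theta>\<close> the factor \<open>(x - \<theta>) ^ i\<close>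
      vanishes unless \<open>i = 0\<close>.\<close>
    have "G \<theta> = (\<Sum>i\<le>n. if i = 0 then - g 0 \<theta> else 0)"
      unfolding G_def by (intro sum.cong) auto
    then show ?thesis
      by (simp add: g_def exp_twist_def)
  qed
  ultimately show ?thesis
    \<comment> \<open>The density is 0 to the left of \<open>\<theta>\<close>, so the half-line
      extends to the whole line.\<close>
    using has_integral_on_superset[of _ "v y \<theta>" "{\<theta>..}" UNIV]
    by (simp add: erlang_location_eq[OF \<open>k \<ge> 1\<close>])
qed

section \<open>Measurability of the kernel, and the conclusion\<close>

text \<open>A derivative is the pointwise limit of difference quotients along one sequence of
  nonzero steps independent of \<open>y\<close>. The induction keeps \<open>t\<close> arbitrary
  because the quotients also use \<open>t + h n\<close>.\<close>

lemma higher_deriv_measurable: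
  fixes w :: "'a \<Rightarrow> real \<Rightarrow> real"
  assumes "\<And>t. (\<lambda>y. w y t) \<in> borel_measurable M"
    and "\<And>y. y \<in> space M \<Longrightarrow> times_differentiable k (w y)" and "j \<le> k"
  shows "(\<lambda>y. (deriv ^^ j) (w y) t) \<in> borel_measurable M"
  using assms(3)
proof (induction j arbitrary: t)
  case 0
  then show ?case
    using assms(1) by simp
next
  case (Suc j)
  define h where "h = (\<lambda>n. inverse (real (Suc n)))"
  show ?case
  proof (rule borel_measurable_LIMSEQ_real)
    show "(\<lambda>y. ((deriv ^^ j) (w y) (t + h n) - (deriv ^^ j) (w y) t) / h n) \<in> borel_measurable M"
      for n
      using Suc by (intro borel_measurable_divide borel_measurable_diff Suc.IH) auto
  next
    fix y assume "y \<in> space M"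
    then have "((\<lambda>u. ((deriv ^^ j) (w y) (t + u) - (deriv ^^ j) (w y) t) / u)
        \<longlongrightarrow> (deriv ^^ Suc j) (w y) t) (at 0)"
      using times_differentiable_has_derivative[OF assms(2), of y j t] Suc.prems
      by (auto simp: DERIV_def)
    moreover have "filterlim h (at 0) sequentially"
      using LIMSEQ_inverse_real_of_nat by (auto simp: filterlim_at h_def simp del: of_nat_Suc)
    ultimately show "(\<lambda>n. ((deriv ^^ j) (w y) (t + h n) - (deriv ^^ j) (w y) t) / h n)
        \<longlonglongrightarrow> (deriv ^^ Suc j) (w y) t"
      by (rule filterlim_compose)
  qed
qed

lemma erlang_kernel_measurable:
  assumes "\<And>t. (\<lambda>y. v y t) \<in> borel_measurable M"
    and "\<And>y. y \<in> space M \<Longrightarrow> times_differentiable k (v y)"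
  shows "(\<lambda>y. erlang_kernel k lam v y x) \<in> borel_measurable M"
proof -
  have "(\<lambda>y. \<Sum>j=0..k. real (k choose j) * inverse lam ^ j * ((-1) ^ j * (deriv ^^ j) (v y) x))
      \<in> borel_measurable M"
    using assms by (intro borel_measurable_sum borel_measurable_times borel_measurable_const
      higher_deriv_measurable[where k = k]) auto
  then show ?thesis
    by (rule measurable_cong[THEN iffD1, rotated])
      (use assms(2) in \<open>auto simp: erlang_kernel_def higher_deriv_reflect[where k = k]
        intro!: sum.cong\<close>)
qed

text \<open>Integrability is asserted separately because \<open>integral\<close> defaults to 0 on
  non-integrable functions; it ensures that the deficiency involves genuine integrals.\<close>

theorem proposition3:
  fixes k :: nat and lam :: real and \<Theta> :: "real set"
    and Y :: "'a::euclidean_space set" and v :: "'a \<Rightarrow> real \<Rightarrow> real"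
  assumes "k \<ge> 1" and "lam > 0"
    and "Y \<in> sets lebesgue"
    and "\<And>\<theta>. prob_density_on Y (\<lambda>y. v y \<theta>)"
    and "\<And>y. y \<in> Y \<Longrightarrow> times_differentiable k (v y)"
    and "\<And>y w j. y \<in> Y \<Longrightarrow> j \<le> k - 1 \<Longrightarrow>
      ((\<lambda>x. x ^ (k - 1) * exp (- lam * x) * (deriv ^^ j) (v y) (x + w)) \<longlongrightarrow> 0) at_top"
    and "\<And>y w. k \<ge> 2 \<Longrightarrow> y \<in> Y \<Longrightarrow> ((\<lambda>x. x * v y (x + w)) \<longlongrightarrow> 0) (at 0)"
    and "\<And>y w j. k \<ge> 2 \<Longrightarrow> y \<in> Y \<Longrightarrow> j \<le> k - 1 \<Longrightarrow>
      ((\<lambda>x. x ^ (k - 1) * (deriv ^^ j) (v y) (x + w)) \<longlongrightarrow> 0) (at 0)"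
  shows "(\<forall>x. (\<lambda>y. erlang_kernel k lam v y x) \<in> borel_measurable (lebesgue_on Y)) \<and>
    (\<forall>\<theta>\<in>\<Theta>. \<forall>y\<in>Y. (\<lambda>x. erlang_kernel k lam v y x * erlang_location k lam x \<theta>) integrable_on UNIV) \<and>
    signed_deficiency \<Theta> UNIV Y (erlang_location k lam) v (erlang_kernel k lam v) = 0"
proof -
  have int: "((\<lambda>x. erlang_kernel k lam v y x * erlang_location k lam x \<theta>) has_integral v y \<theta>) UNIV"
    if "y \<in> Y" for y \<theta>
    using assms(1,2) assms(5,6)[OF that] by (rule erlang_kernel_has_integral)
  have "(\<lambda>y. erlang_kernel k lam v y x) \<in> borel_measurable (lebesgue_on Y)" for x
    using assms(4,5) by (intro erlang_kernel_measurable) (auto simp: prob_density_on_def)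
  moreover have "signed_deficiency \<Theta> UNIV Y (erlang_location k lam) v (erlang_kernel k lam v) = 0"
  proof -
    have "(\<integral>\<^sup>+ y. ennreal \<bar>v y \<theta> - integral UNIV
        (\<lambda>x. erlang_kernel k lam v y x * erlang_location k lam x \<theta>)\<bar> \<partial>lebesgue_on Y)
        = (\<integral>\<^sup>+ y. 0 \<partial>lebesgue_on Y)" for \<theta>
      by (intro nn_integral_cong) (simp add: integral_unique[OF int])
    \<comment> \<open>For empty \<open>\<Theta>\<close> the supremum is \<open>bot\<close>, which is
      0 in \<open>ennreal\<close>; otherwise it is a supremum of zeros.\<close>
    then show ?thesis
      by (cases "\<Theta> = {}") (simp_all add: signed_deficiency_def bot_ennreal)
  qed
  ultimately show ?thesis
    using int by (auto simp: integrable_on_def)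
qed

end
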